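(* The function $$o:X_{\mathcal S}\ni[U,V]\longmapsto o(U)-o(V)\in\mathbb R$$ is well defined (i.e. does not depend on the representative of the equivalence class with respect to $\diamond$) and is a linear functional on $X_{\mathcal S}$.
   Context: $\mathcal S$ is the family of all non-empty, compact, convex, centrally symmetric ($V=-V$) subsets of $\mathbb R^2$, with Minkowski addition and multiplication $\lambda V=\{\lambda v: v\in V\}$ by scalars $\lambda\ge 0$. Sets with empty interior are allowed. $X_{\mathcal S}$ is the real vector space $(\mathcal S\times\mathcal S)/\diamond$, where $(U,V)\diamond(P,Q)\iff U+Q=V+P$, with operations $[U,V]+[P,Q]=[U+P,V+Q]$, $\lambda[U,V]=[\lambda U,\lambda V]$ for $\lambda\ge0$, and $(-1)[U,V]=[V,U]$. For $U\in\mathcal S$, $o(U)$ is the perimeter of $U$, i.e. the coefficient in Steiner's formula $m(U+\lambda B)=m(U)+\lambda o(U)+\lambda^2 m(B)$, $\lambda\ge 0$, where $m$ is the two-dimensional Lebesgue measure and $B$ the closed unit disc (so a segment of length $\ell$ has perimeter $2\ell$). *)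

theory Defs
  imports "HOL-Analysis.Analysis"
begin

typedef sym_body =
  "{V :: (real ^ 2) set. V \<noteq> {} \<and> compact V \<and> convex V \<and> uminus ` V = V}"
  morphisms body_set Sym_Body
  by (rule exI[of _ "{0}"]) auto

setup_lifting type_definition_sym_body

lemma minkowski_cancel:
  fixes A B C :: "'a::euclidean_space set"
  assumes sub: "A + C \<subseteq> B + C" and C: "C \<noteq> {}" "compact C" and B: "closed B" "convex B"
  shows "A \<subseteq> B"
proof
  fix a assume a: "a \<in> A"
  show "a \<in> B"
  proof (rule ccontr)
    assume "a \<notin> B"
    then obtain n b where n: "n \<bullet> a < b" "\<forall>x\<in>B. b < n \<bullet> x"
      using separating_hyperplane_closed_point[OF B(2,1)] by blast
    have "continuous_on C (\<lambda>x. n \<bullet> x)"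
      by (intro continuous_intros)
    then obtain c where c: "c \<in> C" "\<forall>x\<in>C. n \<bullet> c \<le> n \<bullet> x"
      using continuous_attains_inf[OF C(2,1)] by blast
    have "a + c \<in> B + C"
      using sub a c(1) by blast
    then obtain b' c' where bc: "b' \<in> B" "c' \<in> C" "a + c = b' + c'"
      by (elim set_plus_elim)
    have "n \<bullet> a + n \<bullet> c = n \<bullet> b' + n \<bullet> c'"
      using bc(3) by (metis inner_add_right)
    moreover have "b < n \<bullet> b'" "n \<bullet> c \<le> n \<bullet> c'"
      using n(2) c(2) bc by auto
    ultimately show False
      using n(1) by linarith
  qed
qed

instantiation sym_body :: comm_monoid_add
begin

lift_definition zero_sym_body :: sym_body is "{0}"
  by simp

lift_definition plus_sym_body :: "sym_body \<Rightarrow> sym_body \<Rightarrow> sym_body" is "(+)"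
proof -
  fix S T :: "(real ^ 2) set"
  assume S: "S \<noteq> {} \<and> compact S \<and> convex S \<and> uminus ` S = S"
    and T: "T \<noteq> {} \<and> compact T \<and> convex T \<and> uminus ` T = T"
  have "compact ((\<lambda>(x, y). x + y) ` (S \<times> T))"
    using S T by (intro compact_continuous_image compact_Times)
      (auto simp: case_prod_unfold intro!: continuous_intros)
  then have "compact (S + T)"
    by (simp add: set_plus_image)
  moreover have "uminus ` (S + T) = uminus ` S + uminus ` T"
    unfolding set_plus_image by (force simp: image_iff)
  moreover have "S + T \<noteq> {}"
    using S T by (auto simp: set_plus_image)
  ultimately show "S + T \<noteq> {} \<and> compact (S + T) \<and> convex (S + T) \<and> uminus ` (S + T) = S + T"
    using S T by (simp add: convex_set_plus)
qed

instance
proof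
  fix a b c :: sym_body
  show "a + b + c = a + (b + c)"
    by transfer (rule add.assoc)
  show "a + b = b + a"
    by transfer (rule add.commute)
  show "0 + a = a"
    by transfer (force simp: set_plus_image image_iff)
qed

end

lemma sym_body_cancel:
  fixes U V W :: sym_body
  assumes "U + W = V + W"
  shows "U = V"
  using assms
proof transfer
  fix A B C :: "(real ^ 2) set"
  assume "A \<noteq> {} \<and> compact A \<and> convex A \<and> uminus ` A = A"
    "B \<noteq> {} \<and> compact B \<and> convex B \<and> uminus ` B = B"
    "C \<noteq> {} \<and> compact C \<and> convex C \<and> uminus ` C = C" "A + C = B + C"
  then show "A = B"
    using minkowski_cancel[of A C B] minkowski_cancel[of B C A]
    by (simp add: compact_imp_closed subset_antisym)
qed

text \<open>
  The scaling of bodies is meant for scalars \<open>c \<ge> 0\<close>. For negative scalars it is not the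
  additive inverse, since \<open>- V = V\<close>; the vector space operation below does not use it there.
\<close>
lift_definition body_scale :: "real \<Rightarrow> sym_body \<Rightarrow> sym_body" is "\<lambda>c V. (*\<^sub>R) c ` V"
proof -
  fix c :: real and V :: "(real ^ 2) set"
  assume V: "V \<noteq> {} \<and> compact V \<and> convex V \<and> uminus ` V = V"
  have "uminus ` (*\<^sub>R) c ` V = (*\<^sub>R) c ` uminus ` V"
    by (simp add: image_image)
  then show "(*\<^sub>R) c ` V \<noteq> {} \<and> compact ((*\<^sub>R) c ` V) \<and> convex ((*\<^sub>R) c ` V)
      \<and> uminus ` (*\<^sub>R) c ` V = (*\<^sub>R) c ` V"
    using V by (simp add: compact_scaling convex_scaling)
qed

lemma body_scale_one: "body_scale 1 V = V"
  by transfer simp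

lemma body_scale_zero: "body_scale 0 V = 0"
  by transfer (auto simp: image_iff)

lemma body_scale_scale: "body_scale a (body_scale b V) = body_scale (a * b) V"
  by transfer (simp add: image_image)

lemma body_scale_add: "body_scale c (U + V) = body_scale c U + body_scale c V"
  by transfer (force simp: set_plus_image image_iff scaleR_right_distrib)

lemma body_scale_add_left:
  assumes "a \<ge> 0" "b \<ge> 0"
  shows "body_scale (a + b) V = body_scale a V + body_scale b V"
  using assms
proof transfer
  fix a b :: real and V :: "(real ^ 2) set"
  assume ab: "0 \<le> a" "0 \<le> b" and V: "V \<noteq> {} \<and> compact V \<and> convex V \<and> uminus ` V = V"
  show "(*\<^sub>R) (a + b) ` V = (*\<^sub>R) a ` V + (*\<^sub>R) b ` V"
  proof
    show "(*\<^sub>R) (a + b) ` V \<subseteq> (*\<^sub>R) a ` V + (*\<^sub>R) b ` V"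
      by (auto simp: scaleR_left_distrib)
    show "(*\<^sub>R) a ` V + (*\<^sub>R) b ` V \<subseteq> (*\<^sub>R) (a + b) ` V"
    proof
      fix z
      assume "z \<in> (*\<^sub>R) a ` V + (*\<^sub>R) b ` V"
      then obtain x y where xy: "x \<in> V" "y \<in> V" "z = a *\<^sub>R x + b *\<^sub>R y"
        by (auto simp: set_plus_image)
      show "z \<in> (*\<^sub>R) (a + b) ` V"
      proof (cases "a + b = 0")
        case True
        then have "a = 0" "b = 0"
          using ab by linarith+
        then show ?thesis
          using xy by auto
      next
        case False
        have "(a / (a + b)) *\<^sub>R x + (b / (a + b)) *\<^sub>R y \<in> V"
          using V ab False xy(1,2) by (intro convexD) (auto simp flip: add_divide_distrib)
        moreover have "z = (a + b) *\<^sub>R ((a / (a + b)) *\<^sub>R x + (b / (a + b)) *\<^sub>R y)"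
          using False by (simp add: xy(3) scaleR_right_distrib)
        ultimately show ?thesis
          by blast
      qed
    qed
  qed
qed

lifting_forget sym_body.lifting

definition diamond :: "sym_body \<times> sym_body \<Rightarrow> sym_body \<times> sym_body \<Rightarrow> bool" where
  "diamond = (\<lambda>(U, V) (P, Q). U + Q = V + P)"

lemma diamond_iff [simp]: "diamond (U, V) (P, Q) \<longleftrightarrow> U + Q = V + P"
  by (simp add: diamond_def)

lemma equivp_diamond: "equivp diamond"
proof (rule equivpI)
  show "reflp diamond"
    by (rule reflpI) (auto simp: diamond_def add.commute)
  show "symp diamond"
    by (rule sympI) (auto simp: diamond_def add.commute)
  show "transp diamond"
  proof (rule transpI)
    fix x y z
    assume *: "diamond x y" "diamond y z"
    obtain U V P Q R S where [simp]: "x = (U, V)" "y = (P, Q)" "z = (R, S)"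
      by (metis surj_pair)
    have eq: "U + Q = V + P" "P + S = Q + R"
      using * by simp_all
    have "(U + S) + Q = (U + Q) + S"
      by (simp add: ac_simps)
    also have "\<dots> = V + (P + S)"
      by (simp only: eq(1) add.assoc)
    also have "\<dots> = (V + R) + Q"
      by (simp only: eq(2) ac_simps)
    finally have "U + S = V + R"
      by (rule sym_body_cancel)
    then show "diamond x z"
      by simp
  qed
qed

quotient_type body_space = "sym_body \<times> sym_body" / diamond
  by (rule equivp_diamond)

lift_definition body_class :: "sym_body \<Rightarrow> sym_body \<Rightarrow> body_space" is "\<lambda>U V. (U, V)" .

lemma body_class_eq_iff: "body_class U V = body_class P Q \<longleftrightarrow> diamond (U, V) (P, Q)"
  by transfer rule

lemma body_class_cases:
  obtains U V where "x = body_class U V"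
proof -
  have "\<exists>U V. x = body_class U V"
    by transfer (metis diamond_iff add.commute surj_pair)
  then show ?thesis
    using that by blast
qed

instantiation body_space :: real_vector
begin

lift_definition zero_body_space :: body_space is "(0, 0)" .

lift_definition plus_body_space :: "body_space \<Rightarrow> body_space \<Rightarrow> body_space"
  is "\<lambda>(U, V) (P, Q). (U + P, V + Q)"
proof clarsimp
  fix U V U' V' P Q P' Q' :: sym_body
  assume *: "U + V' = V + U'" "P + Q' = Q + P'"
  have "U + P + (V' + Q') = (U + V') + (P + Q')"
    by (simp add: ac_simps)
  also have "\<dots> = V + Q + (U' + P')"
    unfolding * by (simp add: ac_simps)
  finally show "U + P + (V' + Q') = V + Q + (U' + P')" .
qed

lift_definition uminus_body_space :: "body_space \<Rightarrow> body_space" is "\<lambda>(U, V). (V, U)"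
  by auto

definition minus_body_space :: "body_space \<Rightarrow> body_space \<Rightarrow> body_space" where
  "minus_body_space x y = x + - y"

lift_definition scaleR_body_space :: "real \<Rightarrow> body_space \<Rightarrow> body_space"
  is "\<lambda>c (U, V). if c \<ge> 0 then (body_scale c U, body_scale c V)
                  else (body_scale (- c) V, body_scale (- c) U)"
  by (auto simp flip: body_scale_add)

lemma zero_body_class: "0 = body_class 0 0"
  by transfer simp

lemma plus_body_class: "body_class U V + body_class P Q = body_class (U + P) (V + Q)"
  by transfer (simp add: ac_simps)

lemma uminus_body_class: "- body_class U V = body_class V U"
  by transfer (simp add: ac_simps)

lemma scaleR_body_class:
  "c *\<^sub>R body_class U V =
    (if c \<ge> 0 then body_class (body_scale c U) (body_scale c V)
     else body_class (body_scale (- c) V) (body_scale (- c) U))"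
  by transfer (simp add: ac_simps)

lemma scaleR_body_class_diff:
  assumes "p \<ge> 0" "q \<ge> 0" "c = p - q"
  shows "c *\<^sub>R body_class U V =
    body_class (body_scale p U + body_scale q V) (body_scale p V + body_scale q U)"
proof (cases "c \<ge> 0")
  case True
  have p: "p = c + q"
    using assms by simp
  show ?thesis
    unfolding p using True assms(2)
    by (simp add: scaleR_body_class body_class_eq_iff body_scale_add_left ac_simps)
next
  case False
  have q: "q = - c + p"
    using assms by simp
  have "- c \<ge> 0"
    using False by simp
  then show ?thesis
    unfolding q body_scale_add_left[OF \<open>- c \<ge> 0\<close> assms(1)] using False
    by (simp add: scaleR_body_class body_class_eq_iff ac_simps)
qed

lemmas body_class_ops = plus_body_class uminus_body_class scaleR_body_class zero_body_class

instance
proof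
  fix x y z :: body_space and a b :: real
  obtain U V where x: "x = body_class U V" by (rule body_class_cases)
  obtain P Q where y: "y = body_class P Q" by (rule body_class_cases)
  obtain R S where z: "z = body_class R S" by (rule body_class_cases)
  show "x + y + z = x + (y + z)"
    by (simp add: x y z body_class_ops ac_simps)
  show "x + y = y + x"
    by (simp add: x y body_class_ops ac_simps)
  show "0 + x = x"
    by (simp add: x body_class_ops)
  show "- x + x = 0"
    by (simp add: x body_class_ops body_class_eq_iff ac_simps)
  show "x - y = x + - y"
    by (rule minus_body_space_def)
  show "a *\<^sub>R (x + y) = a *\<^sub>R x + a *\<^sub>R y"
    by (simp add: x y body_class_ops body_scale_add)
  show "1 *\<^sub>R x = x"
    by (simp add: x body_class_ops body_scale_one)
  have "a * b = 0 \<Longrightarrow> a = 0 \<or> b = 0"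
    by simp
  then show "a *\<^sub>R b *\<^sub>R x = (a * b) *\<^sub>R x"
    by (cases "a \<ge> 0"; cases "b \<ge> 0")
      (auto simp: x body_class_ops body_scale_scale body_scale_zero zero_le_mult_iff)
  have "(a + b) *\<^sub>R x = body_class
      (body_scale (max a 0 + max b 0) U + body_scale (max (- a) 0 + max (- b) 0) V)
      (body_scale (max a 0 + max b 0) V + body_scale (max (- a) 0 + max (- b) 0) U)"
    unfolding x by (rule scaleR_body_class_diff) auto
  moreover have "c *\<^sub>R x = body_class
      (body_scale (max c 0) U + body_scale (max (- c) 0) V)
      (body_scale (max c 0) V + body_scale (max (- c) 0) U)" for c
    unfolding x by (rule scaleR_body_class_diff) auto
  ultimately show "(a + b) *\<^sub>R x = a *\<^sub>R x + b *\<^sub>R x"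
    by (simp add: plus_body_class body_scale_add_left ac_simps)
qed

end

text \<open>
  The perimeter is the coefficient of \<open>r\<close> in Steiner's formula. It is determined by that
  formula (take \<open>r = 1\<close>), and for a segment it is twice the length.
\<close>
definition perimeter :: "sym_body \<Rightarrow> real" where
  "perimeter U = (THE p. \<forall>r\<ge>0.
     measure lebesgue (body_set U + (*\<^sub>R) r ` cball 0 1) =
       measure lebesgue (body_set U) + r * p + r\<^sup>2 * measure lebesgue (cball 0 1 :: (real ^ 2) set))"

end

theory Submission
  imports Defs
begin

text \<open>
  For a segment \<open>[-v, v]\<close>, the area of \<open>K + t [-v, v]\<close> is affine in \<open>t \<ge> 0\<close>, and its slope
  depends only on the length of the projection of \<open>K\<close> along \<open>v\<close>, so the slope is Minkowski additive
  in \<open>K\<close>. Adding segments one at a time, \<open>area (K + r Z)\<close> is quadratic in \<open>r\<close> for every zonogon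
  \<open>Z\<close>, with a linear coefficient that is additive and positively homogeneous in \<open>K\<close>. The regular
  \<open>2n\<close>-gons inscribed in the unit disc \<open>B\<close> are zonogons \<open>Z\<close> with \<open>c B \<subseteq> Z \<subseteq> B\<close> for \<open>c = cos (\<pi>/2n)\<close>.
  Since \<open>c K \<subseteq> K\<close>, this gives \<open>c\<^sup>2 area (K + r B) \<le> area (K + r Z) \<le> area (K + r B)\<close>. Letting
  \<open>n \<rightarrow> \<infinity>\<close> yields Steiner's formula, with the perimeter as a limit of additive homogeneous functionals.
\<close>

section \<open>Area and elementary geometry of symmetric bodies\<close>

definition area :: "sym_body \<Rightarrow> real" where
  "area K = measure lebesgue (body_set K)"

lemma body_set_props: "body_set K \<noteq> {}" "compact (body_set K)" "convex (body_set K)"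
  and uminus_body_set: "uminus ` body_set K = body_set K"
  using body_set[of K] by auto

lemma body_set_uminus: "x \<in> body_set K \<Longrightarrow> - x \<in> body_set K"
  using uminus_body_set by blast

lemma zero_in_body_set: "0 \<in> body_set K"
proof -
  obtain x where x: "x \<in> body_set K"
    using body_set_props(1) by blast
  have "(1/2) *\<^sub>R x + (1/2) *\<^sub>R (- x) \<in> body_set K"
    using x by (intro convexD[OF body_set_props(3)] body_set_uminus) auto
  then show ?thesis
    by simp
qed

text \<open>\<open>c *\<^sub>R x\<close> is the convex combination of \<open>x\<close> and
  \<open>- x\<close> with weights \<open>(1 + c)/2\<close> and \<open>(1 - c)/2\<close>.\<close>

lemma scaleR_in_body_set:
  assumes "x \<in> body_set K" "\<bar>c\<bar> \<le> 1"
  shows "c *\<^sub>R x \<in> body_set K"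
proof -
  have "((1 + c)/2) *\<^sub>R x + ((1 - c)/2) *\<^sub>R (- x) \<in> body_set K"
    using assms by (intro convexD[OF body_set_props(3)] body_set_uminus) (auto simp: field_simps)
  moreover have "((1 + c)/2) *\<^sub>R x + ((1 - c)/2) *\<^sub>R (- x) = ((1 + c)/2 - (1 - c)/2) *\<^sub>R x"
    by (simp add: scaleR_left_diff_distrib)
  moreover have "(1 + c)/2 - (1 - c)/2 = c"
    by (simp add: field_simps)
  ultimately show ?thesis
    by metis
qed

lemma body_set_plus_mono:
  "body_set K \<subseteq> body_set K' \<Longrightarrow> body_set L \<subseteq> body_set L' \<Longrightarrow> body_set (K + L) \<subseteq> body_set (K' + L')"
  by (simp add: plus_sym_body.rep_eq set_plus_mono2)

lemma body_set_subset_add: "body_set K \<subseteq> body_set (K + L)"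
  using zero_in_body_set[of L] by (force simp: plus_sym_body.rep_eq set_plus_def)

lemma lmeasurable_body_set: "body_set K \<in> lmeasurable"
  by (simp add: body_set_props lmeasurable_compact)

lemma area_mono: "body_set K \<subseteq> body_set L \<Longrightarrow> area K \<le> area L"
  unfolding area_def
  by (intro measure_mono_fmeasurable lmeasurable_body_set fmeasurableD)

lemma area_zero: "area 0 = 0"
  by (simp add: area_def zero_sym_body.rep_eq)

lemma area_scale: "area (body_scale c K) = c\<^sup>2 * area K"
  using measure_lebesgue_linear_transformation[of "body_set K" "(*\<^sub>R) c"]
    lmeasurable_body_set[of K] compact_imp_bounded[OF body_set_props(2)[of K]]
  by (simp add: area_def body_scale.rep_eq)

section \<open>Centred segments\<close>

definition seg :: "real ^ 2 \<Rightarrow> sym_body" where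
  "seg v = Sym_Body (closed_segment (- v) v)"

lemma body_set_seg: "body_set (seg v) = {t *\<^sub>R v |t. \<bar>t\<bar> \<le> 1}"
proof -
  have comb: "a *\<^sub>R (- v) + b *\<^sub>R v = (b - a) *\<^sub>R v" for a b
    by (simp add: scaleR_left_diff_distrib)
  have *: "closed_segment (- v) v = {t *\<^sub>R v |t. \<bar>t\<bar> \<le> 1}"
  proof
    show "closed_segment (- v) v \<subseteq> {t *\<^sub>R v |t. \<bar>t\<bar> \<le> 1}"
    proof
      fix x assume "x \<in> closed_segment (- v) v"
      then obtain u where u: "0 \<le> u" "u \<le> 1" "x = (1 - u) *\<^sub>R (- v) + u *\<^sub>R v"
        by (auto simp: closed_segment_def)
      have "x = (u - (1 - u)) *\<^sub>R v"
        unfolding u(3) comb ..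
      moreover have "\<bar>u - (1 - u)\<bar> \<le> 1"
        using u by auto
      ultimately show "x \<in> {t *\<^sub>R v |t. \<bar>t\<bar> \<le> 1}"
        by blast
    qed
    show "{t *\<^sub>R v |t. \<bar>t\<bar> \<le> 1} \<subseteq> closed_segment (- v) v"
    proof clarify
      fix t :: real assume t: "\<bar>t\<bar> \<le> 1"
      have "(1 + t) / 2 - (1 - (1 + t) / 2) = t"
        by (simp add: field_simps)
      then have "t *\<^sub>R v = (1 - (1 + t) / 2) *\<^sub>R (- v) + ((1 + t) / 2) *\<^sub>R v"
        by (simp only: comb)
      then show "t *\<^sub>R v \<in> closed_segment (- v) v"
        unfolding closed_segment_def using t by (intro CollectI exI[of _ "(1 + t) / 2"]) auto
    qed
  qed
  have "- x \<in> {t *\<^sub>R v |t. \<bar>t\<bar> \<le> 1}" if "x \<in> {t *\<^sub>R v |t. \<bar>t\<bar> \<le> 1}" for x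
    using that by clarify (metis abs_minus_cancel scaleR_minus_left)
  then have "uminus ` closed_segment (- v) v = closed_segment (- v) v"
    unfolding * by (metis (no_types, lifting) image_eqI image_subset_iff minus_minus subsetI subset_antisym)
  then have "body_set (seg v) = closed_segment (- v) v"
    unfolding seg_def by (intro Sym_Body_inverse) auto
  then show ?thesis
    by (simp add: *)
qed

lemma body_set_scale_seg:
  assumes "0 \<le> a"
  shows "body_set (body_scale a (seg v)) = {t *\<^sub>R v |t. \<bar>t\<bar> \<le> a}"
proof (cases "a = 0")
  case True
  then show ?thesis
    by (auto simp: body_scale_zero zero_sym_body.rep_eq)
next
  case False
  have "\<exists>s. t *\<^sub>R v = (a * s) *\<^sub>R v \<and> \<bar>s\<bar> \<le> 1" if "\<bar>t\<bar> \<le> a" for t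
    using that assms False by (intro exI[of _ "t / a"]) auto
  moreover have "\<bar>a * t\<bar> \<le> a" if "\<bar>t\<bar> \<le> 1" for t
    using that assms by (simp add: abs_mult mult_left_le)
  ultimately show ?thesis
    by (fastforce simp: body_scale.rep_eq body_set_seg image_iff)
qed

lemma body_set_add_seg:
  assumes "0 \<le> a"
  shows "body_set (K + body_scale a (seg v)) = {x + t *\<^sub>R v |x t. x \<in> body_set K \<and> \<bar>t\<bar> \<le> a}"
  unfolding plus_sym_body.rep_eq body_set_scale_seg[OF assms] set_plus_def by blast

lemma seg_zero: "seg 0 = 0"
proof -
  have "body_set (seg 0) = body_set 0"
    by (auto simp: body_set_seg zero_sym_body.rep_eq intro: exI[of _ 0])
  then show ?thesis
    by (simp add: body_set_inject)
qed

lemma area_seg: "area (seg v) = 0"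
proof -
  have "body_set (seg v) \<subseteq> span {v}"
    by (auto simp: body_set_seg span_base span_scale)
  then have "dim (body_set (seg v)) \<le> card {v}"
    by (rule dim_le_card) simp
  then have "negligible (body_set (seg v))"
    by (intro negligible_lowdim) simp
  then show ?thesis
    by (simp add: area_def negligible_imp_measure0)
qed

section \<open>Area growth under addition of a segment\<close>

text \<open>Since a segment has area 0, this is twice the mixed area of \<open>K\<close> and
  \<open>seg v\<close>.\<close>

definition seg_gain :: "real ^ 2 \<Rightarrow> sym_body \<Rightarrow> real" where
  "seg_gain v K = area (K + seg v) - area K"

text \<open>Cauchy's functional equation on the half-line, with monotonicity as the regularity
  condition. Both \<open>n * g t\<close> and \<open>n * t * g 1\<close> lie between consecutive
  multiples of \<open>g 1\<close>, so they differ by at most \<open>g 1\<close> for every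
  \<open>n\<close>.\<close>

lemma additive_mono_linear:
  fixes g :: "real \<Rightarrow> real"
  assumes add: "\<And>s t. 0 \<le> s \<Longrightarrow> 0 \<le> t \<Longrightarrow> g (s + t) = g s + g t"
    and mono: "\<And>s t. 0 \<le> s \<Longrightarrow> s \<le> t \<Longrightarrow> g s \<le> g t"
    and t: "0 \<le> t"
  shows "g t = t * g 1"
proof -
  have g0: "g 0 = 0"
    using add[of 0 0] by simp
  have mult: "g (real n * s) = real n * g s" if "0 \<le> s" for n s
  proof (induction n)
    case (Suc n)
    then show ?case
      using that add[of "real n * s" s] by (simp add: algebra_simps)
  qed (simp add: g0)
  have bound: "real n * \<bar>g t - t * g 1\<bar> \<le> g 1" for n
  proof -
    define m where "m = nat \<lfloor>real n * t\<rfloor>"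
    have m: "real m \<le> real n * t" "real n * t \<le> real m + 1"
      using t by (simp_all add: m_def)
    have "g (real m) \<le> g (real n * t)" "g (real n * t) \<le> g (real (Suc m))"
      using m by (auto intro!: mono simp: add.commute)
    then have "real m * g 1 \<le> real n * g t" "real n * g t \<le> (real m + 1) * g 1"
      using mult[of 1 m] mult[of 1 "Suc m"] mult[OF t, of n] by (simp_all add: add.commute)
    moreover have "real m * g 1 \<le> real n * t * g 1" "real n * t * g 1 \<le> (real m + 1) * g 1"
      using m mono[of 0 1] g0 by (intro mult_right_mono; simp)+
    ultimately have "\<bar>real n * g t - real n * t * g 1\<bar> \<le> g 1"
      by (simp add: algebra_simps abs_le_iff)
    then show ?thesis
      by (metis abs_mult abs_of_nat mult.assoc right_diff_distrib)
  qed
  have "\<bar>g t - t * g 1\<bar> = 0"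
  proof (rule ccontr)
    assume "\<bar>g t - t * g 1\<bar> \<noteq> 0"
    then obtain n where "g 1 < real n * \<bar>g t - t * g 1\<bar>"
      using reals_Archimedean3 by (metis abs_ge_zero order_le_less)
    then show False
      using bound[of n] by simp
  qed
  then show ?thesis
    by simp
qed

text \<open>
  The strip over \<open>[-s - t, s + t]\<close> is the union of translates of the strips over \<open>[-s, s]\<close>
  and \<open>[-t, t]\<close>, which by convexity meet in a translate of \<open>K\<close>.
\<close>
lemma area_add_seg_add:
  assumes s: "0 \<le> s" and t: "0 \<le> t"
  shows "area (K + body_scale (s + t) (seg v)) + area K =
    area (K + body_scale s (seg v)) + area (K + body_scale t (seg v))"
proof -
  let ?K = "body_set K"
  let ?S = "body_set (K + body_scale s (seg v))" and ?T = "body_set (K + body_scale t (seg v))"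
  \<comment> \<open>The translations move the parameter intervals to \<open>[-s - t, s - t]\<close>
    and \<open>[s - t, s + t]\<close>, which share exactly the point \<open>s - t\<close>.\<close>
  let ?A = "(+) ((- t) *\<^sub>R v) ` ?S" and ?B = "(+) (s *\<^sub>R v) ` ?T"
  have A: "x \<in> ?A \<longleftrightarrow> (\<exists>r. - s - t \<le> r \<and> r \<le> s - t \<and> x - r *\<^sub>R v \<in> ?K)" for x
  proof
    assume "x \<in> ?A"
    then obtain y r where "y \<in> ?K" "\<bar>r\<bar> \<le> s" "x = (- t) *\<^sub>R v + (y + r *\<^sub>R v)"
      by (auto simp: body_set_add_seg[OF s])
    then show "\<exists>r. - s - t \<le> r \<and> r \<le> s - t \<and> x - r *\<^sub>R v \<in> ?K"
      by (intro exI[of _ "r - t"]) (auto simp: algebra_simps)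
  next
    assume "\<exists>r. - s - t \<le> r \<and> r \<le> s - t \<and> x - r *\<^sub>R v \<in> ?K"
    then obtain r where r: "- s - t \<le> r" "r \<le> s - t" "x - r *\<^sub>R v \<in> ?K"
      by blast
    have "x + t *\<^sub>R v = (x - r *\<^sub>R v) + (r + t) *\<^sub>R v" "\<bar>r + t\<bar> \<le> s"
      using r by (auto simp: algebra_simps)
    then have "x + t *\<^sub>R v \<in> ?S"
      using r(3) unfolding body_set_add_seg[OF s] by blast
    then show "x \<in> ?A"
      by (intro image_eqI[of _ _ "x + t *\<^sub>R v"]) auto
  qed
  have B: "x \<in> ?B \<longleftrightarrow> (\<exists>r. s - t \<le> r \<and> r \<le> s + t \<and> x - r *\<^sub>R v \<in> ?K)" for x
  proof
    assume "x \<in> ?B"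
    then obtain y r where "y \<in> ?K" "\<bar>r\<bar> \<le> t" "x = s *\<^sub>R v + (y + r *\<^sub>R v)"
      by (auto simp: body_set_add_seg[OF t])
    then show "\<exists>r. s - t \<le> r \<and> r \<le> s + t \<and> x - r *\<^sub>R v \<in> ?K"
      by (intro exI[of _ "r + s"]) (auto simp: algebra_simps)
  next
    assume "\<exists>r. s - t \<le> r \<and> r \<le> s + t \<and> x - r *\<^sub>R v \<in> ?K"
    then obtain r where r: "s - t \<le> r" "r \<le> s + t" "x - r *\<^sub>R v \<in> ?K"
      by blast
    have "x - s *\<^sub>R v = (x - r *\<^sub>R v) + (r - s) *\<^sub>R v" "\<bar>r - s\<bar> \<le> t"
      using r by (auto simp: algebra_simps)
    then have "x - s *\<^sub>R v \<in> ?T"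
      using r(3) unfolding body_set_add_seg[OF t] by blast
    then show "x \<in> ?B"
      by (intro image_eqI[of _ _ "x - s *\<^sub>R v"]) auto
  qed
  have U: "x \<in> body_set (K + body_scale (s + t) (seg v)) \<longleftrightarrow>
      (\<exists>r. - s - t \<le> r \<and> r \<le> s + t \<and> x - r *\<^sub>R v \<in> ?K)" for x
  proof -
    have "x \<in> body_set (K + body_scale (s + t) (seg v)) \<longleftrightarrow>
        (\<exists>r. \<bar>r\<bar> \<le> s + t \<and> x - r *\<^sub>R v \<in> ?K)"
      unfolding body_set_add_seg[OF add_nonneg_nonneg[OF s t]] mem_Collect_eq
      by (metis add_diff_cancel_right' diff_add_cancel)
    moreover have "\<bar>r\<bar> \<le> s + t \<longleftrightarrow> - s - t \<le> r \<and> r \<le> s + t" for r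
      by auto
    ultimately show ?thesis
      by simp
  qed
  have un: "body_set (K + body_scale (s + t) (seg v)) = ?A \<union> ?B"
  proof (rule set_eqI)
    fix x
    show "x \<in> body_set (K + body_scale (s + t) (seg v)) \<longleftrightarrow> x \<in> ?A \<union> ?B"
      unfolding U A B Un_iff using s t
      by (smt (verit, ccfv_threshold))
  qed
  have int: "?A \<inter> ?B = (+) ((s - t) *\<^sub>R v) ` ?K"
  proof (rule set_eqI)
    fix x
    \<comment> \<open>By convexity the parameters \<open>r\<close> with
      \<open>x - r *\<^sub>R v\<close> in \<open>K\<close> form an interval. It contains
      \<open>p\<close> and \<open>q\<close>, hence also \<open>s - t\<close> between them.\<close>
    have "x - (s - t) *\<^sub>R v \<in> ?K"
      if p: "x - p *\<^sub>R v \<in> ?K" "p \<le> s - t" and q: "x - q *\<^sub>R v \<in> ?K" "s - t \<le> q" for p q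
    proof (cases "p = q")
      case True
      then show ?thesis
        using p q by (metis order_antisym)
    next
      case False
      define u where "u = (s - t - p) / (q - p)"
      have u: "0 \<le> u" "u \<le> 1" "p + u * (q - p) = s - t"
        using p q False by (auto simp: u_def field_simps)
      have "(1 - u) *\<^sub>R (x - p *\<^sub>R v) + u *\<^sub>R (x - q *\<^sub>R v) \<in> ?K"
        using u p q by (intro convexD[OF body_set_props(3)]) auto
      also have "(1 - u) *\<^sub>R (x - p *\<^sub>R v) + u *\<^sub>R (x - q *\<^sub>R v) = x - (p + u * (q - p)) *\<^sub>R v"
        by (simp add: algebra_simps)
      finally show ?thesis
        by (simp only: u(3))
    qed
    moreover have "x \<in> (+) ((s - t) *\<^sub>R v) ` ?K \<longleftrightarrow> x - (s - t) *\<^sub>R v \<in> ?K"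
      by (auto simp: image_iff) (metis add_diff_cancel_left' diff_add_cancel add.commute)
    moreover have "- s - t \<le> s - t" "s - t \<le> s + t"
      using s t by auto
    ultimately show "x \<in> ?A \<inter> ?B \<longleftrightarrow> x \<in> (+) ((s - t) *\<^sub>R v) ` ?K"
      unfolding Int_iff A B by blast
  qed
  have "measure lebesgue (?A \<union> ?B) + measure lebesgue (?A \<inter> ?B)
      = measure lebesgue ?A + measure lebesgue ?B"
    using measure_Un3[OF measurable_translation[OF lmeasurable_body_set]
        measurable_translation[OF lmeasurable_body_set]]
    by (simp only: diff_add_cancel)
  then show ?thesis
    unfolding area_def un[symmetric] int measure_translation .
qed

text \<open>The increase of area is additive in \<open>t\<close> by \<open>area_add_seg_add\<close>
  and monotone by inclusion, so \<open>additive_mono_linear\<close> applies.\<close>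

lemma area_add_scale_seg:
  assumes "0 \<le> t"
  shows "area (K + body_scale t (seg v)) = area K + t * seg_gain v K"
proof -
  let ?g = "\<lambda>t. area (K + body_scale t (seg v)) - area K"
  have "?g t = t * ?g 1"
  proof (rule additive_mono_linear[OF _ _ assms])
    fix s t :: real assume "0 \<le> s" "0 \<le> t"
    then show "?g (s + t) = ?g s + ?g t"
      using area_add_seg_add[of s t K v] by simp
  next
    fix s t :: real assume st: "0 \<le> s" "s \<le> t"
    have "body_scale t (seg v) = body_scale s (seg v) + body_scale (t - s) (seg v)"
      using st body_scale_add_left[of s "t - s"] by simp
    then show "?g s \<le> ?g t"
      using area_mono[OF body_set_subset_add[of "K + body_scale s (seg v)"]]
      by (simp add: add.assoc)
  qed
  then show ?thesis
    by (simp add: seg_gain_def body_scale_one algebra_simps)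
qed

text \<open>Adding \<open>n\<close> copies of the segment to both sides preserves the inclusion.
  Both areas are then affine in \<open>n\<close>, and \<open>s\<close> enters only the constant
  term, so large \<open>n\<close> forces the slopes into the same order.\<close>

lemma seg_gain_mono:
  assumes s: "0 \<le> s" and sub: "body_set K \<subseteq> body_set (L + body_scale s (seg v))"
  shows "seg_gain v K \<le> seg_gain v L"
proof (rule ccontr)
  assume "\<not> ?thesis"
  then have pos: "seg_gain v K - seg_gain v L > 0"
    by simp
  then obtain n where n: "area L + s * seg_gain v L - area K < real n * (seg_gain v K - seg_gain v L)"
    using reals_Archimedean3 by blast
  have "body_set (K + body_scale n (seg v)) \<subseteq>
      body_set ((L + body_scale s (seg v)) + body_scale n (seg v))"
    by (intro body_set_plus_mono sub order_refl)
  also have "(L + body_scale s (seg v)) + body_scale n (seg v) = L + body_scale (s + n) (seg v)"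
    using s by (simp add: body_scale_add_left add.assoc)
  finally have "area (K + body_scale n (seg v)) \<le> area (L + body_scale (s + n) (seg v))"
    by (rule area_mono)
  then show False
    using n s by (simp add: area_add_scale_seg algebra_simps)
qed

section \<open>Support functions\<close>

definition support :: "sym_body \<Rightarrow> real ^ 2 \<Rightarrow> real" where
  "support K u = (SUP x\<in>body_set K. u \<bullet> x)"

lemma support_eqI:
  assumes "x \<in> body_set K" "\<And>y. y \<in> body_set K \<Longrightarrow> u \<bullet> y \<le> u \<bullet> x"
  shows "support K u = u \<bullet> x"
  unfolding support_def using assms by (intro cSup_eq_maximum) auto

lemma support_attained:
  obtains x where "x \<in> body_set K" "support K u = u \<bullet> x" "\<And>y. y \<in> body_set K \<Longrightarrow> u \<bullet> y \<le> u \<bullet> x"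
proof -
  have "continuous_on (body_set K) (\<lambda>x. u \<bullet> x)"
    by (intro continuous_intros)
  then obtain x where x: "x \<in> body_set K" "\<And>y. y \<in> body_set K \<Longrightarrow> u \<bullet> y \<le> u \<bullet> x"
    using continuous_attains_sup[OF body_set_props(2,1)] by blast
  moreover have "support K u = u \<bullet> x"
    using x by (rule support_eqI)
  ultimately show ?thesis
    using that by blast
qed

lemma support_ge: "y \<in> body_set K \<Longrightarrow> u \<bullet> y \<le> support K u"
  by (metis support_attained)

lemma support_nonneg: "0 \<le> support K u"
  using support_ge[OF zero_in_body_set] by simp

lemma support_zero: "support 0 u = 0"
  by (simp add: support_def zero_sym_body.rep_eq)

lemma support_add: "support (K + L) u = support K u + support L u"
proof -
  obtain x where x: "x \<in> body_set K" "support K u = u \<bullet> x" "\<And>y. y \<in> body_set K \<Longrightarrow> u \<bullet> y \<le> u \<bullet> x"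
    using support_attained[of K "u"] by blast
  obtain z where z: "z \<in> body_set L" "support L u = u \<bullet> z" "\<And>y. y \<in> body_set L \<Longrightarrow> u \<bullet> y \<le> u \<bullet> z"
    using support_attained[of L "u"] by blast
  have "support (K + L) u = u \<bullet> (x + z)"
    using x z by (intro support_eqI)
      (auto simp: plus_sym_body.rep_eq set_plus_def inner_add_right intro!: add_mono)
  then show ?thesis
    using x z by (simp add: inner_add_right)
qed

lemma support_sum: "support (\<Sum>i\<in>I. K i) u = (\<Sum>i\<in>I. support (K i) u)"
  by (induction I rule: infinite_finite_induct) (simp_all add: support_zero support_add)

lemma support_scale: "0 \<le> c \<Longrightarrow> support (body_scale c K) u = c * support K u"
proof -
  assume c: "0 \<le> c"
  obtain x where x: "x \<in> body_set K" "support K u = u \<bullet> x" "\<And>y. y \<in> body_set K \<Longrightarrow> u \<bullet> y \<le> u \<bullet> x"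
    using support_attained[of K "u"] by blast
  have "support (body_scale c K) u = u \<bullet> (c *\<^sub>R x)"
    using x c by (intro support_eqI) (auto simp: body_scale.rep_eq intro!: mult_left_mono)
  then show ?thesis
    using x by simp
qed

lemma support_seg: "support (seg v) u = \<bar>u \<bullet> v\<bar>"
proof -
  \<comment> \<open>The maximiser is the endpoint on the side of \<open>u\<close>; if
    \<open>u\<close> is orthogonal to \<open>v\<close>, the centre serves.\<close>
  have "support (seg v) u = u \<bullet> (sgn (u \<bullet> v) *\<^sub>R v)"
  proof (rule support_eqI)
    show "sgn (u \<bullet> v) *\<^sub>R v \<in> body_set (seg v)"
      unfolding body_set_seg by (auto simp: sgn_if intro: exI[of _ "sgn (u \<bullet> v)"])
  next
    fix y assume "y \<in> body_set (seg v)"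
    then obtain t where t: "y = t *\<^sub>R v" "\<bar>t\<bar> \<le> 1"
      by (auto simp: body_set_seg)
    have "t * (u \<bullet> v) \<le> \<bar>t\<bar> * \<bar>u \<bullet> v\<bar>"
      by (metis abs_ge_self abs_mult)
    also have "\<dots> \<le> \<bar>u \<bullet> v\<bar>"
      using t by (simp add: mult_left_le_one_le)
    finally show "u \<bullet> y \<le> u \<bullet> (sgn (u \<bullet> v) *\<^sub>R v)"
      by (simp add: t abs_sgn mult.commute)
  qed
  then show ?thesis
    by (simp add: abs_sgn mult.commute)
qed

lemma body_set_subset_iff_support:
  "body_set K \<subseteq> body_set L \<longleftrightarrow> (\<forall>u. support K u \<le> support L u)"
proof
  assume "body_set K \<subseteq> body_set L"
  then show "\<forall>u. support K u \<le> support L u"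
    by (metis support_attained support_ge subsetD)
next
  assume le: "\<forall>u. support K u \<le> support L u"
  show "body_set K \<subseteq> body_set L"
  proof
    fix a assume a: "a \<in> body_set K"
    show "a \<in> body_set L"
    proof (rule ccontr)
      assume "a \<notin> body_set L"
      then obtain n b where n: "n \<bullet> a < b" "\<forall>x\<in>body_set L. b < n \<bullet> x"
        using separating_hyperplane_closed_point[OF body_set_props(3) compact_imp_closed[OF body_set_props(2)]]
        by blast
      \<comment> \<open>The separating functional \<open>n\<close> is larger on \<open>L\<close>
        than at \<open>a\<close>, so the support functions are compared in direction
        \<open>- n\<close>.\<close>
      obtain x where x: "x \<in> body_set L" "support L (- n) = (- n) \<bullet> x"
        using support_attained[of L "- n"] by blast
      have "(- n) \<bullet> a \<le> (- n) \<bullet> x"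
        using support_ge[OF a, of "- n"] le x(2) by (metis order_trans)
      then show False
        using n x(1) by fastforce
    qed
  qed
qed

section \<open>Projection along a segment and additivity of the gain\<close>

text \<open>Rotation by a right angle. It preserves the norm, so coordinates with respect to
  \<open>perp v\<close> and \<open>v\<close> both have denominator
  \<open>v \<bullet> v\<close>.\<close>

definition perp :: "real ^ 2 \<Rightarrow> real ^ 2" where
  "perp v = vector [- (v $ 2), v $ 1]"

lemma perp_decomposition:
  assumes "v \<noteq> 0"
  shows "y = ((perp v \<bullet> y) / (v \<bullet> v)) *\<^sub>R perp v + ((v \<bullet> y) / (v \<bullet> v)) *\<^sub>R v"
proof -
  have "(v \<bullet> v) *\<^sub>R y = (perp v \<bullet> y) *\<^sub>R perp v + (v \<bullet> y) *\<^sub>R v"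
    by (simp add: perp_def vec_eq_iff forall_2 inner_vec_def sum_2 algebra_simps)
  then have "(1 / (v \<bullet> v)) *\<^sub>R (v \<bullet> v) *\<^sub>R y =
      (1 / (v \<bullet> v)) *\<^sub>R ((perp v \<bullet> y) *\<^sub>R perp v + (v \<bullet> y) *\<^sub>R v)"
    by (rule arg_cong)
  then show ?thesis
    using assms by (simp add: scaleR_right_distrib)
qed

text \<open>\<open>seg_gain v\<close> depends only on the projection of the body along \<open>v\<close>, which is a segment.\<close>
lemma seg_gain_eq_support:
  assumes v: "v \<noteq> 0"
  shows "seg_gain v K = support K (perp v) * (seg_gain (perp v) (seg v) / (v \<bullet> v))"
proof -
  let ?w = "perp v"
  \<comment> \<open>With this factor, \<open>body_scale a (seg ?w)\<close> is the orthogonal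
    projection of \<open>K\<close> onto the line through \<open>?w\<close>.\<close>
  define a where "a = support K ?w / (v \<bullet> v)"
  have vv: "v \<bullet> v > 0"
    using v by simp
  have a: "0 \<le> a"
    using support_nonneg vv by (simp add: a_def)
  obtain b where b: "\<And>x. x \<in> body_set K \<Longrightarrow> norm x \<le> b"
    using compact_imp_bounded[OF body_set_props(2)] by (meson bounded_iff)
  \<comment> \<open>A bound for the \<open>v\<close>-coordinates of all points of \<open>K\<close>.
    Up to the summand \<open>body_scale s (seg v)\<close>, \<open>K\<close> and its projection then
    contain each other, so \<open>seg_gain_mono\<close> gives both inequalities.\<close>
  define s where "s = norm v * b / (v \<bullet> v)"
  have vx: "\<bar>(v \<bullet> x) / (v \<bullet> v)\<bar> \<le> s" if "x \<in> body_set K" for x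
  proof -
    have "\<bar>v \<bullet> x\<bar> \<le> norm v * norm x"
      by (rule Cauchy_Schwarz_ineq2)
    also have "\<dots> \<le> norm v * b"
      using b[OF that] by (intro mult_left_mono) auto
    finally show ?thesis
      using vv by (simp add: s_def divide_right_mono)
  qed
  have s: "0 \<le> s"
    using vx[OF zero_in_body_set[of K]] by simp
  have "seg_gain v K \<le> seg_gain v (body_scale a (seg ?w))"
  proof (rule seg_gain_mono[OF s])
    show "body_set K \<subseteq> body_set (body_scale a (seg ?w) + body_scale s (seg v))"
    proof
      fix x assume x: "x \<in> body_set K"
      have "?w \<bullet> x \<le> support K ?w" "- (?w \<bullet> x) \<le> support K ?w"
        using support_ge[OF x] support_ge[OF body_set_uminus[OF x], of ?w] by auto
      then have "\<bar>(?w \<bullet> x) / (v \<bullet> v)\<bar> \<le> a"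
        using vv by (simp add: a_def divide_right_mono abs_le_iff)
      then have "((?w \<bullet> x) / (v \<bullet> v)) *\<^sub>R ?w \<in> body_set (body_scale a (seg ?w))"
        unfolding body_set_scale_seg[OF a] by blast
      then show "x \<in> body_set (body_scale a (seg ?w) + body_scale s (seg v))"
        unfolding body_set_add_seg[OF s] using vx[OF x] perp_decomposition[OF v, of x] by blast
    qed
  qed
  moreover have "seg_gain v (body_scale a (seg ?w)) \<le> seg_gain v K"
  proof (rule seg_gain_mono[OF s])
    obtain x where x: "x \<in> body_set K" "support K ?w = ?w \<bullet> x"
      using support_attained[of K "?w"] by blast
    \<comment> \<open>Removing the \<open>v\<close>-component of a maximiser leaves an endpoint of
      the projected segment; symmetry and convexity supply the rest of the segment.\<close>
    define z where "z = x - ((v \<bullet> x) / (v \<bullet> v)) *\<^sub>R v"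
    have "z \<in> body_set (K + body_scale s (seg v))"
      unfolding body_set_add_seg[OF s]
      using x(1) vx[OF x(1)]
      by (intro CollectI exI[of _ x] exI[of _ "- ((v \<bullet> x) / (v \<bullet> v))"]) (simp add: z_def)
    moreover have z: "z = a *\<^sub>R ?w"
      using perp_decomposition[OF v, of x] by (simp add: z_def a_def x(2) algebra_simps)
    ultimately have mem: "a *\<^sub>R ?w \<in> body_set (K + body_scale s (seg v))"
      by simp
    show "body_set (body_scale a (seg ?w)) \<subseteq> body_set (K + body_scale s (seg v))"
      using scaleR_in_body_set[OF mem]
      by (auto simp: body_scale.rep_eq body_set_seg mult.commute)
  qed
  ultimately have "seg_gain v K = seg_gain v (body_scale a (seg ?w))"
    by simp
  \<comment> \<open>The two segments change roles: area growth of \<open>seg v\<close> along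
    \<open>?w\<close> is linear in \<open>a\<close>, which isolates the dependence on
    \<open>K\<close>.\<close>
  also have "\<dots> = area (seg v + body_scale a (seg ?w))"
    by (simp add: seg_gain_def area_scale area_seg add.commute)
  also have "\<dots> = a * seg_gain ?w (seg v)"
    by (simp add: area_add_scale_seg[OF a] area_seg)
  finally show ?thesis
    by (simp add: a_def)
qed

text \<open>Inherited from additivity of support functions. The case \<open>v = 0\<close> is
  separate because \<open>seg_gain_eq_support\<close> divides by \<open>v \<bullet> v\<close>; there
  the gain is 0.\<close>

lemma seg_gain_add: "seg_gain v (K + L) = seg_gain v K + seg_gain v L"
  by (cases "v = 0")
    (simp add: seg_gain_def seg_zero,
      simp add: seg_gain_eq_support support_add algebra_simps add_divide_distrib)

lemma seg_gain_scale: "0 \<le> c \<Longrightarrow> seg_gain v (body_scale c K) = c * seg_gain v K"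
  by (cases "v = 0")
    (simp add: seg_gain_def seg_zero, simp add: seg_gain_eq_support support_scale)

section \<open>Quadratic area formula for zonogons\<close>

lemma body_scale_zero_right: "body_scale c 0 = 0"
  using body_scale_scale[of c 0 0] by (simp add: body_scale_zero)

text \<open>Induction on the segments: with \<open>Z\<close> already added, a further segment
  contributes \<open>r * seg_gain v (K + r Z)\<close>, which splits into a term linear in
  \<open>r\<close> and a quadratic one free of \<open>K\<close>. Hence \<open>c\<close> is chosen
  before \<open>K\<close> and \<open>r\<close>.\<close>

lemma area_add_zonogon:
  obtains c where "\<And>K r. 0 \<le> r \<Longrightarrow> area (K + body_scale r (\<Sum>i\<in>I. seg (v i))) =
    area K + r * (\<Sum>i\<in>I. seg_gain (v i) K) + r\<^sup>2 * c"
proof -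
  have "\<exists>c. \<forall>K r. 0 \<le> r \<longrightarrow> area (K + body_scale r (\<Sum>i\<in>I. seg (v i))) =
    area K + r * (\<Sum>i\<in>I. seg_gain (v i) K) + r\<^sup>2 * c"
  proof (induction I rule: infinite_finite_induct)
    case (insert i I)
    let ?Z = "\<Sum>i\<in>I. seg (v i)"
    from insert obtain c where c: "\<And>K r. 0 \<le> r \<Longrightarrow> area (K + body_scale r ?Z) =
      area K + r * (\<Sum>i\<in>I. seg_gain (v i) K) + r\<^sup>2 * c"
      by blast
    have "area (K + body_scale r (\<Sum>i\<in>insert i I. seg (v i))) =
      area K + r * (\<Sum>i\<in>insert i I. seg_gain (v i) K) + r\<^sup>2 * (c + seg_gain (v i) ?Z)"
      if r: "0 \<le> r" for K r
    proof -
      have *: "K + body_scale r (\<Sum>i\<in>insert i I. seg (v i)) =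
          (K + body_scale r ?Z) + body_scale r (seg (v i))"
        using insert(1,2) by (simp add: body_scale_add ac_simps)
      show ?thesis
        unfolding * area_add_scale_seg[OF r] c[OF r] seg_gain_add seg_gain_scale[OF r]
        using insert(1,2) by (simp add: algebra_simps power2_eq_square)
    qed
    then show ?case
      by blast
  \<comment> \<open>For an empty or infinite index set both sums are 0, and \<open>c = 0\<close>
    works.\<close>
  qed (auto simp: body_scale_zero_right intro: exI[of _ 0])
  then show ?thesis
    using that by blast
qed


section \<open>The unit disc and inscribed regular polygons\<close>

lemma body_scale_subset: "\<bar>c\<bar> \<le> 1 \<Longrightarrow> body_set (body_scale c K) \<subseteq> body_set K"
  by (auto simp: body_scale.rep_eq scaleR_in_body_set)

lemma body_scale_mono:
  "body_set K \<subseteq> body_set L \<Longrightarrow> body_set (body_scale c K) \<subseteq> body_set (body_scale c L)"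
  by (auto simp: body_scale.rep_eq)

definition disc :: sym_body where
  "disc = Sym_Body (cball 0 1)"

lemma body_set_disc: "body_set disc = cball 0 1"
proof -
  have "uminus ` cball 0 1 = (cball 0 1 :: (real ^ 2) set)"
    using minus_image_eq_vimage[of "cball (0 :: real ^ 2) 1"] by auto
  then show ?thesis
    unfolding disc_def by (intro Sym_Body_inverse) auto
qed

lemma support_disc: "support disc u = norm u"
proof -
  have norm: "u \<bullet> sgn u = norm u"
    by (cases "u = 0") (simp_all add: sgn_div_norm power2_norm_eq_inner[symmetric] power2_eq_square)
  have "support disc u = u \<bullet> sgn u"
  proof (rule support_eqI)
    show "sgn u \<in> body_set disc"
      by (simp add: body_set_disc norm_sgn)
  next
    fix y assume "y \<in> body_set disc"
    then have "norm u * norm y \<le> norm u"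
      by (simp add: body_set_disc mult_left_le)
    then show "u \<bullet> y \<le> u \<bullet> sgn u"
      using norm_cauchy_schwarz[of u y] by (simp add: norm)
  qed
  then show ?thesis
    by (simp add: norm)
qed

text \<open>
  The sum has period \<open>d\<close> in \<open>x\<close>, so \<open>x\<close> may be moved to \<open>[\<pi>/2 - d, \<pi>/2]\<close>. There all cosines are
  nonnegative and the sum telescopes.
\<close>
lemma sum_abs_cos_bounds:
  fixes m :: nat and x :: real
  defines "d \<equiv> pi / real (Suc m)"
  shows "cos (d/2) \<le> sin (d/2) * (\<Sum>k<Suc m. \<bar>cos (x - real k * d)\<bar>)"
    and "sin (d/2) * (\<Sum>k<Suc m. \<bar>cos (x - real k * d)\<bar>) \<le> 1"
proof -
  define S where "S x = (\<Sum>k<Suc m. \<bar>cos (x - real k * d)\<bar>)" for x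
  have d: "0 < d" "d \<le> pi" "real m * d = pi - d"
    by (simp_all add: d_def field_simps)
  \<comment> \<open>The shift drops the term with index \<open>m\<close> and brings in
    \<open>\<bar>cos (x + d)\<bar>\<close>. The two agree because their arguments differ by
    \<open>pi\<close>.\<close>
  have per: "S (x + d) = S x" for x
  proof -
    have "S (x + d) = \<bar>cos (x + d)\<bar> + (\<Sum>k<m. \<bar>cos (x - real k * d)\<bar>)"
      unfolding S_def by (subst sum.lessThan_Suc_shift) (simp add: algebra_simps)
    also have "\<bar>cos (x + d)\<bar> = \<bar>cos (x - real m * d)\<bar>"
    proof -
      have "x - real m * d = (x + d) - pi"
        using d by simp
      then show ?thesis
        by (simp only: cos_diff) simp
    qed
    finally show ?thesis
      by (simp add: S_def)
  qed
  interpret S: periodic_fun_simple S d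
    by standard (rule per)
  define y where "y = x + of_int \<lfloor>(pi/2 - x) / d\<rfloor> * d"
  have "of_int \<lfloor>(pi/2 - x) / d\<rfloor> * d \<le> pi/2 - x" "pi/2 - x \<le> (of_int \<lfloor>(pi/2 - x) / d\<rfloor> + 1) * d"
    using floor_divide_lower[OF d(1)] floor_divide_upper[OF d(1)] by (auto intro: less_imp_le)
  then have y: "pi/2 - d \<le> y" "y \<le> pi/2"
    by (auto simp: y_def algebra_simps)
  have "sin (d/2) * S x = sin (d/2) * S y"
    by (simp add: y_def S.plus_of_int)
  also have "\<dots> = (\<Sum>k<Suc m. sin (d/2) * cos (y - real k * d))"
  proof -
    have "0 \<le> cos (y - real k * d)" if "k < Suc m" for k
    proof (rule cos_ge_zero)
      have "real k * d \<le> real m * d" "0 \<le> real k * d"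
        using that d(1) by (auto intro: mult_right_mono)
      then show "- (pi/2) \<le> y - real k * d" "y - real k * d \<le> pi/2"
        using y d by linarith+
    qed
    then show ?thesis
      by (simp add: S_def sum_distrib_left del: sum.lessThan_Suc)
  qed
  \<comment> \<open>The product-to-sum formula makes each term a difference of sines half a step to
    either side.\<close>
  also have "\<dots> = (\<Sum>k<Suc m. sin (y + d/2 - real k * d) / 2 - sin (y + d/2 - real (Suc k) * d) / 2)"
  proof (intro sum.cong refl)
    fix k
    have e: "y + d/2 - real k * d = (y - real k * d) + d/2"
        "y + d/2 - real (Suc k) * d = (y - real k * d) - d/2"
      by (simp_all add: field_simps)
    show "sin (d/2) * cos (y - real k * d) =
        sin (y + d/2 - real k * d) / 2 - sin (y + d/2 - real (Suc k) * d) / 2"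
      unfolding e sin_add[of _ "d/2"] sin_diff[of _ "d/2"] by (simp add: field_simps)
  qed
  also have "\<dots> = sin (y + d/2) / 2 - sin (y + d/2 - real (Suc m) * d) / 2"
    by (subst sum_lessThan_telescope') simp
  also have "real (Suc m) * d = pi"
    by (simp add: d_def)
  also have "sin (y + d/2 - pi) = - sin (y + d/2)"
    by (simp add: sin_diff)
  finally have eq: "sin (d/2) * S x = sin (y + d/2)"
    by simp
  then show "sin (d/2) * (\<Sum>k<Suc m. \<bar>cos (x - real k * d)\<bar>) \<le> 1"
    by (simp add: S_def)
  \<comment> \<open>The range of \<open>y\<close> puts \<open>y + d/2\<close> within
    \<open>d/2\<close> of \<open>pi/2\<close>.\<close>
  have "cos (d/2) \<le> cos \<bar>y + d/2 - pi/2\<bar>"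
    using y d by (intro cos_monotone_0_pi_le) linarith+
  also have "\<dots> = sin (y + d/2)"
    by (simp add: cos_diff)
  finally show "cos (d/2) \<le> sin (d/2) * (\<Sum>k<Suc m. \<bar>cos (x - real k * d)\<bar>)"
    using eq by (simp add: S_def)
qed

text \<open>Half an edge vector: \<open>d\<close> is the central angle of the regular
  \<open>2 * Suc m\<close>-gon in the unit circle, whose sides have length
  \<open>2 * sin (d/2)\<close>. One vector is taken from each pair of parallel sides.\<close>

definition gon_edge :: "nat \<Rightarrow> nat \<Rightarrow> real ^ 2" where
  "gon_edge m k = (let d = pi / real (Suc m) in
    sin (d/2) *\<^sub>R vector [cos (real k * d), sin (real k * d)])"

definition gon :: "nat \<Rightarrow> sym_body" where
  "gon m = (\<Sum>k<Suc m. seg (gon_edge m k))"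

text \<open>Compared through support functions: in direction \<open>x\<close> that of the polygon is
  \<open>sin (d/2)\<close> times the cosine sum bounded in \<open>sum_abs_cos_bounds\<close>. The
  factor \<open>cos (d/2)\<close> is the inradius.\<close>

lemma gon_bounds:
  shows "body_set (gon m) \<subseteq> body_set disc"
    and "body_set (body_scale (cos (pi / real (Suc m) / 2)) disc) \<subseteq> body_set (gon m)"
proof -
  define d where "d = pi / real (Suc m)"
  have d: "0 < d" "d \<le> pi"
    by (simp_all add: d_def field_simps)
  have s: "0 \<le> sin (d/2)" "0 \<le> cos (d/2)"
    using d by (auto intro!: sin_ge_zero cos_ge_zero)
  have *: "cos (d/2) * norm u \<le> support (gon m) u \<and> support (gon m) u \<le> norm u" for u
  proof -
    obtain x where x: "u $ 1 = norm u * cos x" "u $ 2 = norm u * sin x"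
    proof (cases "u = 0")
      case True
      then show ?thesis using that[of 0] by simp
    next
      case False
      have "(u $ 1)\<^sup>2 + (u $ 2)\<^sup>2 = (norm u)\<^sup>2"
        unfolding power2_norm_eq_inner by (simp add: inner_vec_def sum_2 power2_eq_square)
      then have "(u $ 1 / norm u)\<^sup>2 + (u $ 2 / norm u)\<^sup>2 = 1"
        using False by (simp add: power_divide flip: add_divide_distrib)
      then obtain t where "u $ 1 / norm u = cos t" "u $ 2 / norm u = sin t"
        using sincos_total_2pi by metis
      then show ?thesis
        using that[of t] False by (simp add: field_simps)
    qed
    have "\<bar>u \<bullet> gon_edge m k\<bar> = norm u * sin (d/2) * \<bar>cos (x - real k * d)\<bar>" for k
    proof -
      have "u \<bullet> gon_edge m k = norm u * sin (d/2) * cos (x - real k * d)"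
        unfolding gon_edge_def Let_def d_def[symmetric] cos_diff
        by (simp add: inner_vec_def sum_2 x algebra_simps)
      then show ?thesis
        using s by (simp add: abs_mult)
    qed
    then have eq: "support (gon m) u = norm u * (sin (d/2) * (\<Sum>k<Suc m. \<bar>cos (x - real k * d)\<bar>))"
      unfolding gon_def support_sum support_seg by (simp only: sum_distrib_left mult.assoc)
    show ?thesis
      unfolding eq using sum_abs_cos_bounds[where m = m and x = x, folded d_def]
      by (simp only: mult.commute[of "cos (d/2)"] mult_left_mono mult_left_le norm_ge_zero simp_thms)
  qed
  show "body_set (gon m) \<subseteq> body_set disc"
    using * by (simp add: body_set_subset_iff_support support_disc)
  show "body_set (body_scale (cos (pi / real (Suc m) / 2)) disc) \<subseteq> body_set (gon m)"
    unfolding d_def[symmetric] using * s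
    by (simp add: body_set_subset_iff_support support_disc support_scale)
qed

section \<open>Passage to the limit and Steiner's formula\<close>

lemma area_add_gon_tendsto:
  "(\<lambda>m. area (K + body_scale r (gon m))) \<longlonglongrightarrow> area (K + body_scale r disc)"
proof (rule tendsto_sandwich)
  let ?c = "\<lambda>m. cos (pi / real (Suc m) / 2)"
  have "(\<lambda>m. pi / real (Suc m)) \<longlonglongrightarrow> 0"
    by (rule lim_const_over_n[THEN LIMSEQ_Suc])
  then have "(\<lambda>m. (?c m)\<^sup>2 * area (K + body_scale r disc)) \<longlonglongrightarrow>
      (cos (0 / 2))\<^sup>2 * area (K + body_scale r disc)"
    by (intro tendsto_intros) auto
  then show "(\<lambda>m. (?c m)\<^sup>2 * area (K + body_scale r disc)) \<longlonglongrightarrow> area (K + body_scale r disc)"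
    by simp
  have "(?c m)\<^sup>2 * area (K + body_scale r disc) \<le> area (K + body_scale r (gon m))" for m
  proof -
    \<comment> \<open>Shrinking \<open>K\<close> along with the disc keeps the sum inside
      \<open>K + body_scale r (gon m)\<close> and changes its area by exactly the factor
      \<open>(?c m)\<^sup>2\<close>.\<close>
    have "body_scale (?c m) (K + body_scale r disc) =
        body_scale (?c m) K + body_scale r (body_scale (?c m) disc)"
      by (simp add: body_scale_add body_scale_scale mult.commute)
    then have "body_set (body_scale (?c m) (K + body_scale r disc)) \<subseteq> body_set (K + body_scale r (gon m))"
      by (metis body_set_plus_mono body_scale_subset body_scale_mono gon_bounds(2) abs_cos_le_one)
    then show ?thesis
      by (metis area_mono area_scale)
  qed
  then show "\<forall>\<^sub>F m in sequentially. (?c m)\<^sup>2 * area (K + body_scale r disc) \<le> area (K + body_scale r (gon m))"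
    by simp
  show "\<forall>\<^sub>F m in sequentially. area (K + body_scale r (gon m)) \<le> area (K + body_scale r disc)"
    by (intro always_eventually allI area_mono body_set_plus_mono body_scale_mono gon_bounds order_refl)
qed simp

text \<open>The linear coefficient in Steiner's formula with the disc replaced by
  \<open>gon m\<close>.\<close>

definition gon_gain :: "nat \<Rightarrow> sym_body \<Rightarrow> real" where
  "gon_gain m K = (\<Sum>k<Suc m. seg_gain (gon_edge m k) K)"

lemma gon_gain_add: "gon_gain m (K + L) = gon_gain m K + gon_gain m L"
  by (simp only: gon_gain_def seg_gain_add sum.distrib)

lemma gon_gain_scale: "0 \<le> c \<Longrightarrow> gon_gain m (body_scale c K) = c * gon_gain m K"
  by (simp only: gon_gain_def seg_gain_scale sum_distrib_left)

lemma area_add_gon: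
  assumes "0 \<le> r"
  shows "area (K + body_scale r (gon m)) = area K + r * gon_gain m K + r\<^sup>2 * area (gon m)"
proof -
  obtain c where c: "\<And>K r. 0 \<le> r \<Longrightarrow> area (K + body_scale r (gon m)) =
      area K + r * gon_gain m K + r\<^sup>2 * c"
    unfolding gon_gain_def gon_def using area_add_zonogon[where I = "{..<Suc m}" and v = "gon_edge m"] by blast
  have "gon_gain m 0 = 0"
    using gon_gain_add[of m 0 0] by simp
  \<comment> \<open>The case \<open>K = 0\<close>, \<open>r = 1\<close> identifies the quadratic
    coefficient.\<close>
  then have "area (gon m) = c"
    using c[of 1 0] by (simp add: body_scale_one area_zero)
  then show ?thesis
    using c[OF assms] by simp
qed

text \<open>At \<open>r = 1\<close> the polygon formula expresses \<open>gon_gain m K\<close>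
  through areas whose limits are known; \<open>area (gon m)\<close> is the case
  \<open>K = 0\<close>.\<close>

lemma gon_gain_tendsto: "(\<lambda>m. gon_gain m K) \<longlonglongrightarrow> area (K + disc) - area K - area disc"
proof -
  have "gon_gain m K = area (K + body_scale 1 (gon m)) - area K - area (0 + body_scale 1 (gon m))" for m
    using area_add_gon[of 1 K m] by (simp add: body_scale_one)
  moreover have "(\<lambda>m. area (K + body_scale 1 (gon m)) - area K - area (0 + body_scale 1 (gon m)))
      \<longlonglongrightarrow> area (K + body_scale 1 disc) - area K - area (0 + body_scale 1 disc)"
    by (intro tendsto_intros area_add_gon_tendsto)
  ultimately show ?thesis
    by (simp add: body_scale_one)
qed

lemma steiner_formula:
  assumes "0 \<le> r"
  shows "area (K + body_scale r disc) =
    area K + r * (area (K + disc) - area K - area disc) + r\<^sup>2 * area disc"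
proof (rule LIMSEQ_unique[OF area_add_gon_tendsto])
  have "(\<lambda>m. area (gon m)) \<longlonglongrightarrow> area disc"
    using area_add_gon_tendsto[of 0 1] by (simp add: body_scale_one)
  then show "(\<lambda>m. area (K + body_scale r (gon m))) \<longlonglongrightarrow>
      area K + r * (area (K + disc) - area K - area disc) + r\<^sup>2 * area disc"
    unfolding area_add_gon[OF assms] by (intro tendsto_intros gon_gain_tendsto)
qed

section \<open>The perimeter and its linearity\<close>

text \<open>\<open>steiner_formula\<close> gives existence of the coefficient, and
  \<open>r = 1\<close> gives uniqueness, so the description operator is resolved.\<close>

lemma perimeter_eq: "perimeter K = area (K + disc) - area K - area disc"
proof -
  have "perimeter K = (THE p. \<forall>r\<ge>0. area (K + body_scale r disc) = area K + r * p + r\<^sup>2 * area disc)"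
    by (simp add: perimeter_def area_def plus_sym_body.rep_eq body_scale.rep_eq body_set_disc)
  also have "\<dots> = area (K + disc) - area K - area disc"
  proof (rule the_equality)
    fix p assume "\<forall>r\<ge>0. area (K + body_scale r disc) = area K + r * p + r\<^sup>2 * area disc"
    from this[rule_format, of 1] show "p = area (K + disc) - area K - area disc"
      by (simp add: body_scale_one)
  qed (blast intro: steiner_formula)
  finally show ?thesis .
qed

lemma gon_gain_tendsto_perimeter: "(\<lambda>m. gon_gain m K) \<longlonglongrightarrow> perimeter K"
  unfolding perimeter_eq by (rule gon_gain_tendsto)

lemma perimeter_add: "perimeter (K + L) = perimeter K + perimeter L"
proof (rule LIMSEQ_unique[OF gon_gain_tendsto_perimeter])
  show "(\<lambda>m. gon_gain m (K + L)) \<longlonglongrightarrow> perimeter K + perimeter L"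
    unfolding gon_gain_add by (intro tendsto_intros gon_gain_tendsto_perimeter)
qed

lemma perimeter_scale:
  assumes "0 \<le> c"
  shows "perimeter (body_scale c K) = c * perimeter K"
proof (rule LIMSEQ_unique[OF gon_gain_tendsto_perimeter])
  show "(\<lambda>m. gon_gain m (body_scale c K)) \<longlonglongrightarrow> c * perimeter K"
    unfolding gon_gain_scale[OF assms] by (intro tendsto_intros gon_gain_tendsto_perimeter)
qed

section \<open>Descent to the quotient space\<close>

lemma perimeter_diamond:
  assumes "diamond (U, V) (P, Q)"
  shows "perimeter U - perimeter V = perimeter P - perimeter Q"
proof -
  have "perimeter (U + Q) = perimeter (V + P)"
    using assms by simp
  then show ?thesis
    by (simp add: perimeter_add)
qed

lift_definition perimeter_functional :: "body_space \<Rightarrow> real"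
  is "\<lambda>(U, V). perimeter U - perimeter V"
  by (auto simp del: diamond_iff intro: perimeter_diamond)

lemma perimeter_functional_class: "perimeter_functional (body_class U V) = perimeter U - perimeter V"
  by transfer simp

lemma linear_perimeter_functional: "linear perimeter_functional"
proof (rule linearI)
  fix x y :: body_space and c :: real
  obtain U V where x: "x = body_class U V" by (rule body_class_cases)
  obtain P Q where y: "y = body_class P Q" by (rule body_class_cases)
  show "perimeter_functional (x + y) = perimeter_functional x + perimeter_functional y"
    by (simp add: x y plus_body_class perimeter_functional_class perimeter_add)
  \<comment> \<open>For \<open>c < 0\<close> the two bodies are swapped and scaled by
    \<open>- c\<close>, so \<open>perimeter_scale\<close> applies and the swap accounts for the
    sign.\<close>
  show "perimeter_functional (c *\<^sub>R x) = c *\<^sub>R perimeter_functional x"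
    by (simp add: x scaleR_body_class perimeter_functional_class perimeter_scale algebra_simps)
qed

theorem proposition8:
  shows "(\<forall>U V P Q. diamond (U, V) (P, Q) \<longrightarrow>
            perimeter U - perimeter V = perimeter P - perimeter Q)
       \<and> (\<exists>f :: body_space \<Rightarrow> real.
            (\<forall>U V. f (body_class U V) = perimeter U - perimeter V) \<and> linear f)"
  using perimeter_diamond perimeter_functional_class linear_perimeter_functional by blast

end
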